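(* Let $X$ be an almost zero-dimensional separable metrizable space, and let $\Lambda(X)=\{x\in X : X \text{ is } 1\text{-dimensional at } x\}$. Then $\dim(\Lambda(X))=\dim(X)$. Thus there is no separable metrizable space that is both weakly $1$-dimensional and almost zero-dimensional.
   Context: All spaces are separable and metrizable. $\dim$ denotes the usual topological dimension (for separable metrizable spaces the small inductive, large inductive and covering dimensions coincide), with the convention that the empty space is zero-dimensional, i.e. $\dim(\varnothing)=0$: a space is zero-dimensional if it has a neighbourhood basis of clopen sets, which holds vacuously for $\varnothing$. A C-set in a space $X$ is an intersection of clopen subsets of $X$. A space $X$ is almost zero-dimensional if $X$ has a neighbourhood basis of C-sets, i.e. for every $x\in X$ and every neighbourhood $U$ of $x$ there is a (not necessarily open) neighbourhood of $x$ that is contained in $U$ and is a C-set in $X$. A space $X$ is zero-dimensional at $x\in X$ if every neighbourhood of $x$ contains a clopen neighbourhood of $x$. $X$ is $1$-dimensional at $x$ if $X$ is not zero-dimensional at $x$ but every neighbourhood of $x$ contains an open neighbourhood of $x$ whose boundary has dimension at most $0$. (If $\dim(X)\le 1$, then $X$ is $1$-dimensional at $x$ if and only if $X$ is not zero-dimensional at $x$.) A space $X$ is weakly $1$-dimensional if $\dim(X)=1$ but $\dim(\Lambda(X))=0$. *)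

theory Defs
  imports "HOL-Analysis.Analysis" "HOL-Library.Extended_Nat"
begin

text \<open>
  Topological dimension, taken as the small inductive dimension (on separable metrizable spaces
  it agrees with the large inductive and the covering dimension). The library relation
  \<^const>\<open>dimension_le\<close> starts at \<open>-1\<close> for the empty space; letting \<open>n\<close> range over the natural
  numbers only implements the convention that the empty space has dimension \<open>0\<close>.
  The infimum is \<open>\<infinity>\<close> if there is no finite bound.
\<close>

definition topdim :: "'a topology \<Rightarrow> enat" where
  "topdim X = (INF n \<in> {n::nat. X dim_le int n}. enat n)"

definition C_set_in :: "'a topology \<Rightarrow> 'a set \<Rightarrow> bool" where
  "C_set_in X A \<longleftrightarrow>
     (\<exists>\<U>. \<U> \<noteq> {} \<and> (\<forall>U\<in>\<U>. closedin X U \<and> openin X U) \<and> A = \<Inter>\<U>)"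

definition almost_zero_dimensional :: "'a topology \<Rightarrow> bool" where
  "almost_zero_dimensional X \<longleftrightarrow> neighbourhood_base_of (C_set_in X) X"

definition zero_dimensional_at :: "'a topology \<Rightarrow> 'a \<Rightarrow> bool" where
  "zero_dimensional_at X x \<longleftrightarrow>
     neighbourhood_base_at x (\<lambda>U. closedin X U \<and> openin X U) X"

definition one_dimensional_at :: "'a topology \<Rightarrow> 'a \<Rightarrow> bool" where
  "one_dimensional_at X x \<longleftrightarrow>
     \<not> zero_dimensional_at X x \<and>
     neighbourhood_base_at x
       (\<lambda>U. openin X U \<and> topdim (subtopology X (X frontier_of U)) \<le> 0) X"

definition dimensional_kernel :: "'a topology \<Rightarrow> 'a set" (\<open>\<Lambda>\<close>) where
  "\<Lambda> X = {x \<in> topspace X. one_dimensional_at X x}"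

definition weakly_one_dimensional :: "'a topology \<Rightarrow> bool" where
  "weakly_one_dimensional X \<longleftrightarrow>
     topdim X = 1 \<and> topdim (subtopology X (\<Lambda> X)) = 0"

lemma topdim_le_iff: "topdim X \<le> enat n \<longleftrightarrow> X dim_le int n"
proof
  assume le: "topdim X \<le> enat n"
  have "{n::nat. X dim_le int n} \<noteq> {}"
  proof
    assume "{n::nat. X dim_le int n} = {}"
    then have "topdim X = \<infinity>"
      by (simp only: topdim_def image_empty Inf_empty top_enat_def)
    with le show False
      by simp
  qed
  then have "topdim X \<in> enat ` {n::nat. X dim_le int n}"
    unfolding topdim_def by (metis image_is_empty wellorder_InfI ex_in_conv)
  then obtain m where "X dim_le int m" "topdim X = enat m"
    by auto
  with le show "X dim_le int n"
    by (auto intro: dimension_le_mono)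
next
  assume "X dim_le int n"
  then show "topdim X \<le> enat n"
    unfolding topdim_def by (intro INF_lower) simp
qed

lemma topdim_eq_0_iff:
  "topdim X = 0 \<longleftrightarrow> neighbourhood_base_of (\<lambda>U. closedin X U \<and> openin X U) X"
  using topdim_le_iff[of X 0]
  by (simp add: dimension_le_0_neighbourhood_base_of_clopen flip: zero_enat_def)

lemma topdim_trivial_topology: "topdim trivial_topology = 0"
  by (simp add: topdim_eq_0_iff neighbourhood_base_of_def)

end

theory Submission
  imports Defs
begin

text \<open>
  Disjoint C-sets of an almost zero-dimensional space \<open>X\<close> are separated by a clopen set, and a
  relatively clopen subset of a C-set is the trace of a clopen subset of \<open>X\<close>. If \<open>\<Lambda> X\<close> is
  zero-dimensional, then every point of it has arbitrarily small open neighbourhoods \<open>V\<close> whose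
  frontier misses \<open>\<Lambda> X\<close>. Small clopen sets cover this frontier, the complement of their union
  is a C-set, and extending the trace of \<open>V\<close> on it to a clopen subset of \<open>X\<close> yields a small
  clopen neighbourhood; hence \<open>X\<close> is zero-dimensional. Moreover \<open>X\<close> has dimension at most \<open>1\<close>:
  a weighted sum \<open>\<phi>\<close> of Urysohn functions whose sublevel sets are C-sets generates the
  topology together with the clopen sets, and the level sets of \<open>\<phi>\<close> are zero-dimensional.
\<close>

section \<open>Clopen sets, second countability and countable open covers\<close>

abbreviation clopenin :: "'a topology \<Rightarrow> 'a set \<Rightarrow> bool" where
  "clopenin X U \<equiv> closedin X U \<and> openin X U"

lemma clopenin_Diff: "clopenin X U \<Longrightarrow> clopenin X V \<Longrightarrow> clopenin X (U - V)"
  by (simp add: closedin_diff openin_diff)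

lemma clopenin_Int: "clopenin X U \<Longrightarrow> clopenin X V \<Longrightarrow> clopenin X (U \<inter> V)"
  by (simp add: closedin_Int openin_Int)

lemma clopenin_INT_lessThan:
  fixes C :: "nat \<Rightarrow> 'a set"
  assumes "\<And>i. i < N \<Longrightarrow> clopenin X (C i)"
  shows "clopenin X (topspace X \<inter> (\<Inter>i<N. C i))"
  using assms
proof (induction N)
  case (Suc N)
  have eq: "topspace X \<inter> (\<Inter>i<Suc N. C i) = (topspace X \<inter> (\<Inter>i<N. C i)) \<inter> C N"
    by (auto simp: lessThan_Suc)
  have "clopenin X (topspace X \<inter> (\<Inter>i<N. C i))"
    by (rule Suc.IH) (use Suc.prems in auto)
  then show ?case
    unfolding eq by (rule clopenin_Int) (use Suc.prems in auto)
qed auto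

text \<open>The balls of radius \<open>1/(n+1)\<close> about the points of a countable dense set
  form a base, by the triangle inequality.\<close>

lemma separable_metrizable_imp_second_countable:
  assumes "metrizable_space X" "separable_space X"
  shows "second_countable X"
proof -
  obtain M d where Md: "Metric_space M d" and X: "X = Metric_space.mtopology M d"
    using assms(1) by (auto simp: metrizable_space_def)
  interpret Metric_space M d by (rule Md)
  obtain D where D: "countable D" "D \<subseteq> M" "mtopology closure_of D = M"
    using assms(2) unfolding separable_space_def X by auto
  define \<B> where "\<B> = (\<lambda>(a, n::nat). mball a (inverse (real (Suc n)))) ` (D \<times> UNIV)"
  show ?thesis
    unfolding second_countable_def
  proof (intro exI conjI allI impI ballI)
    show "countable \<B>"
      unfolding \<B>_def using D(1) by blast
    show "openin X V" if "V \<in> \<B>" for V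
      using that by (auto simp: \<B>_def X)
    show "\<exists>V\<in>\<B>. x \<in> V \<and> V \<subseteq> U" if U: "openin X U \<and> x \<in> U" for U x
    proof -
      obtain r where r: "r > 0" "mball x r \<subseteq> U" and xM: "x \<in> M"
        using U unfolding X openin_mtopology by (metis subsetD)
      obtain n where n: "inverse (real (Suc n)) < r / 2"
        using reals_Archimedean[of "r/2"] r(1) by auto
      have pos: "inverse (real (Suc n)) > 0"
        by simp
      have "x \<in> mtopology closure_of D"
        using D(3) xM by simp
      then obtain a where a: "a \<in> D" "a \<in> mball x (inverse (real (Suc n)))"
        using pos unfolding metric_closure_of by blast
      have "mball a (inverse (real (Suc n))) \<subseteq> mball x r"
      proof
        fix y assume y: "y \<in> mball a (inverse (real (Suc n)))"
        then show "y \<in> mball x r"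
          using a(2) n triangle[of x a y] by (auto simp del: of_nat_Suc)
      qed
      moreover have "x \<in> mball a (inverse (real (Suc n)))"
        using a commute by auto
      ultimately show ?thesis
        using a(1) r(2) by (intro bexI[of _ "mball a (inverse (real (Suc n)))"]) (auto simp: \<B>_def)
    qed
  qed
qed

text \<open>A Lindelof argument: each base set contained in some open set with property
  \<open>P\<close> selects one such set, and only countably many are selected. The sequence form
  serves the later constructions by layers.\<close>

lemma second_countable_open_cover_sequence:
  assumes "second_countable X" and "P {}"
    and cov: "\<And>x. x \<in> A \<Longrightarrow> \<exists>U. openin X U \<and> x \<in> U \<and> P U"
  obtains U :: "nat \<Rightarrow> 'a set"
  where "\<And>n. openin X (U n)" "\<And>n. P (U n)" "A \<subseteq> (\<Union>n. U n)"
proof -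
  obtain \<B> where \<B>: "countable \<B>" "\<And>V. V \<in> \<B> \<Longrightarrow> openin X V"
    and base: "\<And>U x. openin X U \<and> x \<in> U \<longrightarrow> (\<exists>V \<in> \<B>. x \<in> V \<and> V \<subseteq> U)"
    using assms by (auto simp: second_countable_def)
  define g where "g = (\<lambda>V. SOME U. openin X U \<and> P U \<and> V \<subseteq> U)"
  define \<V> where "\<V> = {V\<in>\<B>. \<exists>U. openin X U \<and> P U \<and> V \<subseteq> U}"
  have g: "openin X (g V) \<and> P (g V) \<and> V \<subseteq> g V" if "V \<in> \<V>" for V
    using that someI_ex[of "\<lambda>U. openin X U \<and> P U \<and> V \<subseteq> U"] unfolding \<V>_def g_def by blast
  \<comment> \<open>Adding the empty set makes the family nonempty, so that
    \<open>from_nat_into\<close> enumerates exactly this family; this is where \<open>P {}\<close>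
    enters.\<close>
  define \<C> where "\<C> = insert {} (g ` \<V>)"
  have "countable \<C>"
    unfolding \<C>_def \<V>_def using \<B>(1) by (auto intro: countable_subset[of _ \<B>])
  then have rng: "range (from_nat_into \<C>) = \<C>"
    by (simp add: \<C>_def range_from_nat_into)
  show thesis
  proof
    have "from_nat_into \<C> n \<in> \<C>" for n
      using rng by blast
    moreover have "openin X U \<and> P U" if "U \<in> \<C>" for U
      using that g assms(2) by (auto simp: \<C>_def)
    ultimately show "openin X (from_nat_into \<C> n)" "P (from_nat_into \<C> n)" for n
      by blast+
    show "A \<subseteq> (\<Union>n. from_nat_into \<C> n)"
    proof
      fix x assume "x \<in> A"
      then obtain U where "openin X U" "x \<in> U" "P U"
        using cov by blast
      moreover obtain V where "V \<in> \<B>" "x \<in> V" "V \<subseteq> U"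
        using base calculation by blast
      ultimately have "V \<in> \<V>" "x \<in> V"
        unfolding \<V>_def by blast+
      then show "x \<in> (\<Union>n. from_nat_into \<C> n)"
        unfolding rng using g unfolding \<C>_def by blast
    qed
  qed
qed

subsection \<open>C-sets\<close>

text \<open>The pointwise form is the one used in all later arguments: complements of the members of
  the family separate outside points from \<open>A\<close>. Conversely, the family of all clopen
  supersets of \<open>A\<close> works, and it is nonempty because it contains
  \<open>topspace X\<close>.\<close>

lemma C_set_in_iff:
  "C_set_in X A \<longleftrightarrow> A \<subseteq> topspace X \<and>
     (\<forall>p\<in>topspace X - A. \<exists>C. clopenin X C \<and> p \<in> C \<and> C \<inter> A = {})"
proof
  assume "C_set_in X A"
  then obtain \<U> where \<U>: "\<U> \<noteq> {}" "\<And>U. U \<in> \<U> \<Longrightarrow> clopenin X U" "A = \<Inter>\<U>"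
    unfolding C_set_in_def by metis
  have "\<exists>C. clopenin X C \<and> p \<in> C \<and> C \<inter> A = {}" if p: "p \<in> topspace X - A" for p
  proof -
    obtain U where "U \<in> \<U>" "p \<notin> U"
      using p \<U>(3) by blast
    moreover have "clopenin X (topspace X - U)"
      using \<U>(2)[OF \<open>U \<in> \<U>\<close>] by (intro clopenin_Diff) auto
    ultimately show ?thesis
      using p unfolding \<U>(3) by blast
  qed
  moreover have "A \<subseteq> topspace X"
    using \<U> closedin_subset by blast
  ultimately show "A \<subseteq> topspace X \<and>
      (\<forall>p\<in>topspace X - A. \<exists>C. clopenin X C \<and> p \<in> C \<and> C \<inter> A = {})"
    by blast
next
  assume R: "A \<subseteq> topspace X \<and>
     (\<forall>p\<in>topspace X - A. \<exists>C. clopenin X C \<and> p \<in> C \<and> C \<inter> A = {})"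
  define \<U> where "\<U> = {U. clopenin X U \<and> A \<subseteq> U}"
  have "topspace X \<in> \<U>"
    using R by (auto simp: \<U>_def)
  moreover have "A = \<Inter>\<U>"
  proof
    show "\<Inter>\<U> \<subseteq> A"
    proof
      fix p assume p: "p \<in> \<Inter>\<U>"
      show "p \<in> A"
      proof (rule ccontr)
        assume "p \<notin> A"
        moreover have "p \<in> topspace X"
          using p \<open>topspace X \<in> \<U>\<close> by blast
        ultimately obtain C where C: "clopenin X C" "p \<in> C" "C \<inter> A = {}"
          using R by (meson DiffI)
        have "clopenin X (topspace X - C)"
          by (intro clopenin_Diff C) auto
        moreover have "A \<subseteq> topspace X - C"
          using R C(3) by blast
        ultimately have "topspace X - C \<in> \<U>"
          by (simp add: \<U>_def)
        then show False
          using p C(2) by blast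
      qed
    qed
  qed (auto simp: \<U>_def)
  moreover have "\<forall>U\<in>\<U>. clopenin X U"
    by (auto simp: \<U>_def)
  ultimately show "C_set_in X A"
    unfolding C_set_in_def by blast
qed

lemma C_set_in_imp_subset: "C_set_in X A \<Longrightarrow> A \<subseteq> topspace X"
  by (simp add: C_set_in_iff)

lemma C_set_in_separate_point:
  assumes "C_set_in X A" "p \<in> topspace X" "p \<notin> A"
  obtains C where "clopenin X C" "p \<in> C" "C \<inter> A = {}"
proof -
  have "\<exists>C. clopenin X C \<and> p \<in> C \<and> C \<inter> A = {}"
    using assms unfolding C_set_in_iff by (meson DiffI)
  then show thesis
    using that by metis
qed

lemma C_set_in_clopen: "clopenin X A \<Longrightarrow> C_set_in X A"
  unfolding C_set_in_def by (intro exI[of _ "{A}"]) auto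

lemma C_set_in_Un:
  assumes "C_set_in X A" "C_set_in X B"
  shows "C_set_in X (A \<union> B)"
  unfolding C_set_in_iff
proof (intro conjI ballI)
  show "A \<union> B \<subseteq> topspace X"
    using assms C_set_in_imp_subset by blast
  fix p assume p: "p \<in> topspace X - (A \<union> B)"
  obtain C where "clopenin X C" "p \<in> C" "C \<inter> A = {}"
    using C_set_in_separate_point[OF assms(1), of p] p by (metis DiffD1 DiffD2 UnCI)
  moreover obtain D where "clopenin X D" "p \<in> D" "D \<inter> B = {}"
    using C_set_in_separate_point[OF assms(2), of p] p by (metis DiffD1 DiffD2 UnCI)
  ultimately show "\<exists>C. clopenin X C \<and> p \<in> C \<and> C \<inter> (A \<union> B) = {}"
    by (intro exI[of _ "C \<inter> D"] conjI clopenin_Int) auto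
qed

lemma C_set_in_UN_atMost:
  fixes A :: "nat \<Rightarrow> 'a set"
  assumes "\<And>i. C_set_in X (A i)"
  shows "C_set_in X (\<Union>i\<le>n. A i)"
proof (induction n)
  case (Suc n)
  then show ?case
    using C_set_in_Un[OF Suc assms[of "Suc n"]] by (simp add: atMost_Suc Un_commute)
qed (use assms in simp)

text \<open>Countably many clopen sets missing \<open>A\<close> cover its complement, and
  \<open>K n\<close> removes the first \<open>n\<close> of them. Starting at
  \<open>K 0 = topspace X\<close> ensures that the layers \<open>K n - K (Suc n)\<close> partition
  the whole complement of \<open>A\<close>.\<close>

lemma C_set_in_decreasing_sequence:
  assumes "second_countable X" "C_set_in X A"
  obtains K :: "nat \<Rightarrow> 'a set"
  where "\<And>n. clopenin X (K n)" "antimono K" "K 0 = topspace X" "A = (\<Inter>n. K n)"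
proof -
  obtain U :: "nat \<Rightarrow> 'a set" where U: "\<And>n. openin X (U n)" 
      "\<And>n. closedin X (U n) \<and> U n \<inter> A = {}" "topspace X - A \<subseteq> (\<Union>n. U n)"
  proof (rule second_countable_open_cover_sequence[where P = "\<lambda>U. closedin X U \<and> U \<inter> A = {}" 
        and A = "topspace X - A"])
    show "\<exists>U. openin X U \<and> x \<in> U \<and> closedin X U \<and> U \<inter> A = {}" if "x \<in> topspace X - A" for x
      using C_set_in_separate_point[OF assms(2), of x] that by (metis DiffD1 DiffD2)
  qed (use assms in auto)
  define K where "K = (\<lambda>n. topspace X \<inter> (\<Inter>i<n. topspace X - U i))"
  have A: "A \<subseteq> topspace X"
    using assms(2) by (rule C_set_in_imp_subset)
  show thesis
  proof
    show "clopenin X (K n)" for n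
      unfolding K_def by (intro clopenin_INT_lessThan clopenin_Diff) (use U in auto)
    show "antimono K"
      unfolding K_def by (intro antimonoI Int_mono INF_superset_mono) auto
    show "K 0 = topspace X"
      by (simp add: K_def)
    show "A = (\<Inter>n. K n)"
    proof
      show "A \<subseteq> (\<Inter>n. K n)"
        using A U(2) by (fastforce simp: K_def)
      show "(\<Inter>n. K n) \<subseteq> A"
      proof
        fix p assume p: "p \<in> (\<Inter>n. K n)"
        show "p \<in> A"
        proof (rule ccontr)
          assume "p \<notin> A"
          moreover have "p \<in> K 0"
            using p by blast
          ultimately obtain n where "p \<in> U n"
            using U(3) by (auto simp: K_def)
          moreover have "p \<in> K (Suc n)"
            using p by blast
          ultimately show False
            unfolding K_def by blast
        qed
      qed
    qed
  qed
qed

text \<open>With \<open>K n\<close> decreasing to \<open>A\<close> and \<open>J n\<close> to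
  \<open>B\<close>, the union of the clopen sets \<open>K n - J n\<close> contains \<open>A\<close>
  and misses \<open>B\<close>. It is closed because this family is locally finite off
  \<open>A\<close>.\<close>

lemma disjoint_C_sets_separated:
  fixes X :: "'a topology"
  assumes "second_countable X" "C_set_in X A" "C_set_in X B" "A \<inter> B = {}"
  obtains G where "clopenin X G" "A \<subseteq> G" "G \<inter> B = {}"
proof -
  obtain K :: "nat \<Rightarrow> 'a set" where K: "\<And>n. clopenin X (K n)" "antimono K" "K 0 = topspace X" "A = (\<Inter>n. K n)"
    using C_set_in_decreasing_sequence[OF assms(1,2)] by blast
  obtain J :: "nat \<Rightarrow> 'a set" where J: "\<And>n. clopenin X (J n)" "antimono J" "J 0 = topspace X" "B = (\<Inter>n. J n)"
    using C_set_in_decreasing_sequence[OF assms(1,3)] by blast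
  define G where "G = (\<Union>n. K n - J n)"
  have KJ: "clopenin X (K n - J n)" for n
    by (intro clopenin_Diff K J)
  have AG: "A \<subseteq> G"
  proof
    fix a assume a: "a \<in> A"
    then have "a \<notin> B" using assms(4) by blast
    then obtain n where "a \<notin> J n" unfolding J(4) by blast
    moreover have "a \<in> K n" using a unfolding K(4) by blast
    ultimately show "a \<in> G" unfolding G_def by blast
  qed
  have Gsub: "G \<subseteq> topspace X"
    using K(1) openin_subset by (force simp: G_def)
  have "openin X (topspace X - G)"
  proof (subst openin_subopen, intro ballI)
    fix p assume p: "p \<in> topspace X - G"
    then have "p \<notin> A" using AG by blast
    then obtain n where n: "p \<notin> K n" using K(4) by blast
    \<comment> \<open>Outside \<open>K n\<close> all members with index at least \<open>n\<close>
      are absent, since \<open>K\<close> decreases; the finitely many earlier ones are removed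
      explicitly.\<close>
    define T where "T = (topspace X - K n) \<inter> (topspace X \<inter> (\<Inter>i<n. topspace X - (K i - J i)))"
    have "clopenin X (topspace X - K n)"
      by (intro clopenin_Diff K) auto
    moreover have "clopenin X (topspace X \<inter> (\<Inter>i<n. topspace X - (K i - J i)))"
      using clopenin_Diff[OF _ KJ, of "topspace X"] by (intro clopenin_INT_lessThan) simp
    ultimately have "clopenin X T"
      unfolding T_def by (rule clopenin_Int)
    moreover have "p \<in> T"
      using p n by (auto simp: T_def G_def)
    moreover have "T \<inter> (K m - J m) = {}" for m
    proof (cases "m < n")
      case False
      then have "K m \<subseteq> K n" using antimonoD[OF K(2)] by simp
      then show ?thesis by (auto simp: T_def)
    qed (auto simp: T_def)
    then have "T \<inter> G = {}"
      unfolding G_def by blast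
    moreover have "T \<subseteq> topspace X"
      unfolding T_def by blast
    ultimately show "\<exists>T. openin X T \<and> p \<in> T \<and> T \<subseteq> topspace X - G"
      by (intro exI[of _ T]) blast
  qed
  moreover have "openin X G"
    unfolding G_def using KJ by (intro openin_Union) auto
  ultimately have "clopenin X G"
    using Gsub by (simp add: closedin_def)
  moreover have "G \<inter> B = {}"
    unfolding G_def J(4) by blast
  ultimately show thesis
    using AG that by blast
qed

text \<open>Countably many interiors of C-sets inside \<open>W\<close> cover \<open>W\<close>.
  Finite unions of C-sets are C-sets, so partial unions make the sequence increasing.\<close>

lemma azd_open_exhaustion:
  assumes "second_countable X" "almost_zero_dimensional X" "openin X W"
  obtains D :: "nat \<Rightarrow> 'a set"
  where "\<And>n. C_set_in X (D n)" "mono D" "\<And>n. D n \<subseteq> W" "W \<subseteq> (\<Union>n. X interior_of D n)"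
proof -
  define P where "P = (\<lambda>U. \<exists>D. C_set_in X D \<and> U \<subseteq> D \<and> D \<subseteq> W)"
  have "C_set_in X {}"
    by (rule C_set_in_clopen) auto
  then have "P {}"
    unfolding P_def by blast
  moreover have "\<exists>U. openin X U \<and> x \<in> U \<and> P U" if "x \<in> W" for x
    using assms(2,3) that unfolding P_def almost_zero_dimensional_def neighbourhood_base_of by meson
  ultimately obtain U :: "nat \<Rightarrow> 'a set"
    where U: "\<And>n. openin X (U n)" "\<And>n. P (U n)" "W \<subseteq> (\<Union>n. U n)"
    using second_countable_open_cover_sequence[OF assms(1), of P W] by blast
  then obtain D :: "nat \<Rightarrow> 'a set" where D: "\<And>n. C_set_in X (D n) \<and> U n \<subseteq> D n \<and> D n \<subseteq> W"
    unfolding P_def by metis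
  show thesis
  proof
    show "C_set_in X (\<Union>i\<le>n. D i)" for n
      using D by (intro C_set_in_UN_atMost) auto
    show "mono (\<lambda>n. \<Union>i\<le>n. D i)"
      by (intro monoI UN_mono) auto
    show "(\<Union>i\<le>n. D i) \<subseteq> W" for n
      using D by blast
    have "U n \<subseteq> X interior_of (\<Union>i\<le>n. D i)" for n
      using D U(1) by (intro interior_of_maximal) auto
    then have "(\<Union>n. U n) \<subseteq> (\<Union>n. X interior_of (\<Union>i\<le>n. D i))"
      by (intro UN_mono) auto
    with U(3) show "W \<subseteq> (\<Union>n. X interior_of (\<Union>i\<le>n. D i))"
      by (rule order_trans)
  qed
qed

section \<open>Constructions along the layers of a decreasing clopen sequence\<close>

lemma layer_of_point:
  fixes K :: "nat \<Rightarrow> 'a set"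
  assumes "p \<in> K m" "p \<notin> (\<Inter>n. K n)" "antimono K"
  obtains n where "m \<le> n" "p \<in> K n - K (Suc n)"
proof -
  obtain k where k: "p \<notin> K k" using assms by blast
  have "\<exists>n\<ge>m. p \<in> K n - K (Suc n)"
  proof (rule ccontr)
    assume "\<not> ?thesis"
    then have step: "p \<in> K n \<Longrightarrow> p \<in> K (Suc n)" if "m \<le> n" for n
      using that by blast
    have "p \<in> K n" if "m \<le> n" for n
      using that by (induction n rule: dec_induct) (use assms(1) step in auto)
    then have "p \<in> K (max m k)" by simp
    then show False
      using k antimonoD[OF assms(3), of k "max m k"] by auto
  qed
  then show thesis using that by blast
qed

lemma layers_disjoint:
  fixes K :: "nat \<Rightarrow> 'a set"
  assumes "antimono K" "m \<noteq> n"
  shows "(K m - K (Suc m)) \<inter> (K n - K (Suc n)) = {}"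
proof -
  have "Suc m \<le> n \<or> Suc n \<le> m" using assms(2) by auto
  then have "K n \<subseteq> K (Suc m) \<or> K m \<subseteq> K (Suc n)"
    using antimonoD[OF assms(1)] by blast
  then show ?thesis by auto
qed

text \<open>A layered union is a neighbourhood of \<open>B\<close> even though the set placed on
  each layer changes: a point of \<open>B\<close> is interior to some \<open>D m\<close>, and all
  layers from the \<open>m\<close>-th on receive a set containing \<open>D m\<close>.\<close>

lemma subset_interior_of_layered_union:
  fixes K D H :: "nat \<Rightarrow> 'a set"
  assumes K: "\<And>n. clopenin X (K n)" "antimono K"
    and KB: "(\<Inter>n. K n) \<inter> (\<Union>m. D m) \<subseteq> B" "B \<subseteq> (\<Inter>n. K n)"
    and D: "B \<subseteq> (\<Union>m. X interior_of D m)" and H: "\<And>m n. m \<le> n \<Longrightarrow> D m \<subseteq> H n"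
  shows "B \<subseteq> X interior_of (B \<union> (\<Union>n. H n \<inter> (K n - K (Suc n))))"
proof
  fix b assume b: "b \<in> B"
  then obtain m where m: "b \<in> X interior_of D m"
    using D by blast
  \<comment> \<open>Intersecting with \<open>K m\<close> discards the layers before
    \<open>m\<close>, on which \<open>H n\<close> need not contain \<open>D m\<close>.\<close>
  have "X interior_of D m \<inter> K m \<subseteq> B \<union> (\<Union>n. H n \<inter> (K n - K (Suc n)))"
  proof
    fix y assume y: "y \<in> X interior_of D m \<inter> K m"
    then have yD: "y \<in> D m"
      using interior_of_subset by fastforce
    show "y \<in> B \<union> (\<Union>n. H n \<inter> (K n - K (Suc n)))"
    proof (cases "y \<in> (\<Inter>n. K n)")
      case True
      then show ?thesis using KB yD by blast
    next
      case False
      then obtain n where "m \<le> n" "y \<in> K n - K (Suc n)"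
        using layer_of_point[OF _ False K(2), of m] y by blast
      then show ?thesis using H yD by blast
    qed
  qed
  moreover have "openin X (X interior_of D m \<inter> K m)"
    using K(1) by (simp add: openin_Int)
  moreover have "b \<in> X interior_of D m \<inter> K m"
    using m b KB by blast
  ultimately show "b \<in> X interior_of (B \<union> (\<Union>n. H n \<inter> (K n - K (Suc n))))"
    by (meson interior_of_maximal subsetD)
qed

text \<open>The analogue of normality that drives the Urysohn construction. Since \<open>W\<close>
  is exhausted by C-sets \<open>D n\<close>, placing \<open>D n\<close> on the \<open>n\<close>-th
  layer around \<open>A\<close> gives a neighbourhood of \<open>A\<close>; it remains a C-set
  because the layers are clopen.\<close>

lemma C_set_in_interpolation:
  fixes X :: "'a topology"
  assumes "second_countable X" "almost_zero_dimensional X" "C_set_in X A" "openin X W" "A \<subseteq> W"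
  obtains B where "C_set_in X B" "A \<subseteq> X interior_of B" "B \<subseteq> W"
proof -
  obtain K :: "nat \<Rightarrow> 'a set" where K: "\<And>n. clopenin X (K n)" "antimono K" "K 0 = topspace X" "A = (\<Inter>n. K n)"
    using C_set_in_decreasing_sequence[OF assms(1,3)] by blast
  obtain D :: "nat \<Rightarrow> 'a set" where D: "\<And>n. C_set_in X (D n)" "mono D" "\<And>n. D n \<subseteq> W" "W \<subseteq> (\<Union>n. X interior_of D n)"
    using azd_open_exhaustion[OF assms(1,2,4)] by blast
  define B where "B = A \<union> (\<Union>n. D n \<inter> (K n - K (Suc n)))"
  have "A \<subseteq> X interior_of B"
    unfolding B_def
    by (rule subset_interior_of_layered_union[where D = D])
       (use K(1,2) D(3,4) monoD[OF D(2)] assms(5) in \<open>simp_all flip: K(4)\<close>)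
  moreover have "B \<subseteq> W"
    using D(3) assms(5) by (auto simp: B_def)
  moreover have "C_set_in X B"
    unfolding C_set_in_iff
  proof (intro conjI ballI)
    show "B \<subseteq> topspace X"
      using C_set_in_imp_subset[OF assms(3)] C_set_in_imp_subset[OF D(1)] unfolding B_def by blast
    fix p assume p: "p \<in> topspace X - B"
    then have "p \<in> K 0" "p \<notin> (\<Inter>n. K n)"
      unfolding K(3) K(4)[symmetric] B_def by blast+
    then obtain n where n: "p \<in> K n - K (Suc n)"
      using layer_of_point[OF _ _ K(2)] by metis
    with p have "p \<in> topspace X" "p \<notin> D n"
      by (auto simp: B_def)
    then obtain C where C: "clopenin X C" "p \<in> C" "C \<inter> D n = {}"
      by (rule C_set_in_separate_point[OF D(1)])
    \<comment> \<open>On the \<open>n\<close>-th layer \<open>B\<close> coincides with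
      \<open>D n\<close>, so separating \<open>p\<close> from \<open>D n\<close> within that layer
      suffices.\<close>
    have "C \<inter> (K n - K (Suc n)) \<inter> B = {}"
    proof -
      have "y \<notin> B" if y: "y \<in> C" "y \<in> K n - K (Suc n)" for y
      proof
        assume "y \<in> B"
        moreover have "y \<notin> A"
          using y(2) unfolding K(4) by blast
        ultimately obtain m where m: "y \<in> D m" "y \<in> K m - K (Suc m)"
          unfolding B_def by blast
        then have "m = n"
          using layers_disjoint[OF K(2), of m n] y(2) by blast
        then show False
          using m(1) y(1) C(3) by blast
      qed
      then show ?thesis by blast
    qed
    moreover have "clopenin X (C \<inter> (K n - K (Suc n)))"
      by (intro clopenin_Int clopenin_Diff C K)
    ultimately show "\<exists>C. clopenin X C \<and> p \<in> C \<and> C \<inter> B = {}"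
      using C(2) n by blast
  qed
  ultimately show thesis
    using that by blast
qed

text \<open>
  Off \<open>A\<close>, the clopen set is built layer by layer on the clopen sets \<open>K n - K (Suc n)\<close>; on
  the \<open>n\<close>-th layer it separates the \<open>n\<close>-th members of C-set exhaustions of disjoint
  neighbourhoods of \<open>B\<close> and \<open>A - B\<close>, so that it becomes open at \<open>B\<close> and coopen at \<open>A - B\<close>.
\<close>
lemma clopen_in_C_set_extends:
  fixes X :: "'a topology"
  assumes "second_countable X" "normal_space X" "almost_zero_dimensional X"
    and A: "C_set_in X A" and "B \<subseteq> A" "closedin X B" "closedin X (A - B)"
  obtains G where "clopenin X G" "G \<inter> A = B"
proof -
  have "disjnt B (A - B)"
    by (simp add: disjnt_def)
  then obtain U V where UV: "openin X U" "openin X V" "B \<subseteq> U" "A - B \<subseteq> V" "disjnt U V"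
    using assms(2,6,7) unfolding normal_space_def by meson
  obtain D :: "nat \<Rightarrow> 'a set" where D: "\<And>n. C_set_in X (D n)" "mono D" "\<And>n. D n \<subseteq> U" "U \<subseteq> (\<Union>n. X interior_of D n)"
    using azd_open_exhaustion[OF assms(1,3) UV(1)] by blast
  obtain E :: "nat \<Rightarrow> 'a set" where E: "\<And>n. C_set_in X (E n)" "mono E" "\<And>n. E n \<subseteq> V" "V \<subseteq> (\<Union>n. X interior_of E n)"
    using azd_open_exhaustion[OF assms(1,3) UV(2)] by blast
  obtain K :: "nat \<Rightarrow> 'a set" where K: "\<And>n. clopenin X (K n)" "antimono K" "K 0 = topspace X" "A = (\<Inter>n. K n)"
    using C_set_in_decreasing_sequence[OF assms(1,4)] by blast
  have "\<exists>H. clopenin X H \<and> D n \<subseteq> H \<and> H \<inter> E n = {}" for n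
  proof -
    have "D n \<inter> E n = {}"
      using D(3)[of n] E(3)[of n] UV(5) by (auto simp: disjnt_iff)
    then show ?thesis
      using disjoint_C_sets_separated[OF assms(1) D(1) E(1)] by metis
  qed
  then obtain H where H: "\<And>n. clopenin X (H n)" "\<And>n. D n \<subseteq> H n" "\<And>n. H n \<inter> E n = {}"
    by metis
  define L where "L = (\<lambda>n. K n - K (Suc n))"
  have L: "openin X (L n)" for n
    using clopenin_Diff[OF K(1)[of n] K(1)[of "Suc n"]] by (simp add: L_def)
  define G where "G = B \<union> (\<Union>n. H n \<inter> L n)"
  \<comment> \<open>The intended complement of \<open>G\<close>, built in the same way with the two
    sides exchanged; openness of both makes \<open>G\<close> clopen.\<close>
  define G' where "G' = (A - B) \<union> (\<Union>n. (topspace X - H n) \<inter> L n)"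
  have Ltop: "L n \<subseteq> topspace X" and LA: "L n \<inter> A = {}" for n
    using openin_subset[OF L[of n]] unfolding L_def K(4) by blast+
  have "B \<subseteq> X interior_of G"
    unfolding G_def L_def
  proof (rule subset_interior_of_layered_union[where D = D])
    \<comment> \<open>The sets \<open>D m\<close> stay in \<open>U\<close>, which misses
      \<open>V\<close> and hence \<open>A - B\<close>.\<close>
    show "(\<Inter>n. K n) \<inter> (\<Union>m. D m) \<subseteq> B"
      using D(3) UV(4,5) unfolding K(4)[symmetric] disjnt_iff by blast
    show "D m \<subseteq> H n" if "m \<le> n" for m n
      using monoD[OF D(2) that] H(2)[of n] by blast
  qed (use K(1,2) D(4) UV(3) assms(5) in \<open>auto simp flip: K(4)\<close>)
  moreover have "(\<Union>n. H n \<inter> L n) \<subseteq> X interior_of G"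
    using H(1) L by (intro interior_of_maximal openin_Union) (auto simp: G_def)
  ultimately have oG: "openin X G"
    by (metis G_def Un_least interior_of_subset interior_of_eq subset_antisym)
  have "A - B \<subseteq> X interior_of G'"
    unfolding G'_def L_def
  proof (rule subset_interior_of_layered_union[where D = E])
    show "(\<Inter>n. K n) \<inter> (\<Union>m. E m) \<subseteq> A - B"
      using E(3) UV(3,5) unfolding K(4)[symmetric] disjnt_iff by blast
    show "E m \<subseteq> topspace X - H n" if "m \<le> n" for m n
      using E(2) H(3)[of n] monoD[OF E(2) that] C_set_in_imp_subset[OF E(1)] by blast
  qed (use K(1,2) E(4) UV(4) assms(5) in \<open>auto simp flip: K(4)\<close>)
  moreover have "(\<Union>n. (topspace X - H n) \<inter> L n) \<subseteq> X interior_of G'"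
    using H(1) L by (intro interior_of_maximal openin_Union) (auto simp: G'_def)
  ultimately have oG': "openin X G'"
    by (metis G'_def Un_least interior_of_subset interior_of_eq subset_antisym)
  have cover: "\<exists>n. p \<in> L n" if "p \<in> topspace X" "p \<notin> A" for p
    using layer_of_point[OF _ _ K(2), of p 0] that unfolding L_def K(3) K(4) by metis
  have dis: "m = n" if "p \<in> L m" "p \<in> L n" for p m n
    using layers_disjoint[OF K(2)] that unfolding L_def by blast
  have GA: "G \<inter> A = B"
    using LA assms(5) unfolding G_def by blast
  have "topspace X - G = G'"
  proof
    show "topspace X - G \<subseteq> G'"
    proof
      fix p assume p: "p \<in> topspace X - G"
      show "p \<in> G'"
      proof (cases "p \<in> A")
        case False
        then obtain n where "p \<in> L n"
          using cover p by blast
        then show ?thesis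
          using p unfolding G_def G'_def by blast
      qed (use p in \<open>simp add: G_def G'_def\<close>)
    qed
    have "G \<inter> G' = {}"
      using dis LA assms(5) unfolding G_def G'_def by blast
    moreover have "G' \<subseteq> topspace X"
      using Ltop C_set_in_imp_subset[OF A] unfolding G'_def by blast
    ultimately show "G' \<subseteq> topspace X - G"
      by blast
  qed
  then have "clopenin X G"
    using oG oG' openin_subset[OF oG] by (simp add: closedin_def)
  then show thesis
    using GA that by blast
qed

subsection \<open>The set of points of positive dimension\<close>

text \<open>A relatively clopen piece \<open>H\<close> of \<open>S\<close> and the rest of
  \<open>S\<close> are separated in \<open>X\<close>, so complete normality of metrizable spaces
  puts them into disjoint open sets \<open>P\<close> and \<open>Q\<close>. The frontier of
  \<open>P \<inter> U1\<close> avoids \<open>H\<close>, which lies inside this open set, and avoids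
  \<open>Q\<close>.\<close>

lemma zero_dimensional_subset_open_frontier:
  assumes "metrizable_space X"
    and S: "neighbourhood_base_of (clopenin (subtopology X S)) (subtopology X S)"
    and "openin X U" "x \<in> U" "x \<in> S"
  obtains V where "openin X V" "x \<in> V" "X closure_of V \<subseteq> U" "(X frontier_of V) \<inter> S = {}"
proof -
  have "regular_space X"
    using assms(1) metrizable_imp_regular_space by blast
  then obtain U1 C where U1: "openin X U1" "closedin X C" "x \<in> U1" "U1 \<subseteq> C" "C \<subseteq> U"
    using assms(3,4) unfolding neighbourhood_base_of_closedin[symmetric] neighbourhood_base_of
    by metis
  have "openin (subtopology X S) (S \<inter> U1)"
    using U1 by (simp add: openin_subtopology_Int2)
  moreover have "x \<in> S \<inter> U1" using U1 assms by blast
  ultimately obtain O' H where "x \<in> O'" "O' \<subseteq> H" and H: "clopenin (subtopology X S) H" "H \<subseteq> S \<inter> U1"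
    using S unfolding neighbourhood_base_of by metis
  then have "x \<in> H" by blast
  define T where "T = topspace (subtopology X S) - H"
  have "closedin (subtopology X S) T"
    using H unfolding T_def by (intro closedin_diff closedin_topspace) auto
  then have "separatedin (subtopology X S) H T"
    using H by (subst separatedin_closed_sets) (auto simp: T_def disjnt_iff)
  then have "separatedin X H T"
    by (simp add: separatedin_subtopology)
  then obtain P Q where PQ: "openin X P" "openin X Q" "H \<subseteq> P" "T \<subseteq> Q" "disjnt P Q"
    using metrizable_space_separation[OF assms(1)] by metis
  show thesis
  proof
    show op: "openin X (P \<inter> U1)"
      using PQ U1 by auto
    show "x \<in> P \<inter> U1"
      using PQ U1 \<open>x \<in> H\<close> by blast
    show "X closure_of (P \<inter> U1) \<subseteq> U"
      using closure_of_minimal[of "P \<inter> U1" C X] U1 by blast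
    \<comment> \<open>An open set disjoint from \<open>P \<inter> U1\<close> is also disjoint from
      its closure.\<close>
    have "X closure_of (P \<inter> U1) \<inter> Q = {}"
      using PQ openin_Int_closure_of_eq_empty[OF PQ(2), of "P \<inter> U1"] by (auto simp: disjnt_iff)
    moreover have "X frontier_of (P \<inter> U1) = X closure_of (P \<inter> U1) - (P \<inter> U1)"
      using op by (simp add: frontier_of_def interior_of_openin)
    moreover have "S \<inter> topspace X \<subseteq> H \<union> Q"
      using PQ by (auto simp: T_def)
    moreover have "H \<subseteq> P \<inter> U1"
      using H PQ by blast
    ultimately show "X frontier_of (P \<inter> U1) \<inter> S = {}"
      using closure_of_subset_topspace[of X "P \<inter> U1"] by blast
  qed
qed

text \<open>Intended for \<open>S = \<Lambda> X\<close>. At a point of \<open>S\<close>, a small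
  open \<open>V\<close> can be chosen whose frontier consists of points covered by
  \<open>off\<close>; this is what allows \<open>V\<close> to be modified into a clopen set.\<close>

lemma azd_zero_dimensional_from_subset:
  assumes "metrizable_space X" "second_countable X" "almost_zero_dimensional X"
    and S: "neighbourhood_base_of (clopenin (subtopology X S)) (subtopology X S)"
    and off: "\<And>x. x \<in> topspace X - S \<Longrightarrow> zero_dimensional_at X x"
  shows "neighbourhood_base_of (clopenin X) X"
  unfolding neighbourhood_base_of
proof (intro allI impI, elim conjE)
  fix U x assume U: "openin X U" "x \<in> U"
  show "\<exists>O' V. openin X O' \<and> clopenin X V \<and> x \<in> O' \<and> O' \<subseteq> V \<and> V \<subseteq> U"
  proof (cases "x \<in> S")
    case False
    then have "zero_dimensional_at X x"
      using off U openin_subset by blast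
    then show ?thesis
      using U unfolding zero_dimensional_at_def neighbourhood_base_at_def by blast
  next
    case True
    obtain V where V: "openin X V" "x \<in> V" "X closure_of V \<subseteq> U" "(X frontier_of V) \<inter> S = {}"
      by (rule zero_dimensional_subset_open_frontier[OF assms(1) S U True])
    have fr: "X frontier_of V = X closure_of V - V"
      using V by (simp add: frontier_of_def interior_of_openin)
    have VX: "V \<subseteq> X closure_of V"
      using V(1) by (simp add: closure_of_subset openin_subset)
    have "t1_space X"
      using assms(1) metrizable_imp_t1_space by blast
    then have oU: "openin X (U - {x})"
      using U(1) by (simp add: t1_space_openin_delete_alt)
    \<comment> \<open>Deleting \<open>x\<close> from \<open>U\<close> keeps \<open>x\<close> in the
      complement \<open>K\<close>, so that the extension of \<open>V \<inter> K\<close> will contain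
      \<open>x\<close>.\<close>
    define \<C> where "\<C> = {C. clopenin X C \<and> C \<subseteq> U - {x}}"
    have frC: "X frontier_of V \<subseteq> \<Union>\<C>"
    proof
      fix z assume z: "z \<in> X frontier_of V"
      then have "z \<in> U - {x}"
        using V fr by blast
      moreover have "zero_dimensional_at X z"
        using z V(4) off frontier_of_subset_topspace[of X V] by blast
      ultimately show "z \<in> \<Union>\<C>"
        using oU unfolding zero_dimensional_at_def neighbourhood_base_at_def \<C>_def by blast
    qed
    define K where "K = topspace X - \<Union>\<C>"
    have K: "C_set_in X K"
      unfolding C_set_in_iff by (auto simp: K_def \<C>_def)
    have "openin X (\<Union>\<C>)"
      by (auto simp: \<C>_def)
    then have cK: "closedin X K"
      by (auto simp: K_def)
    \<comment> \<open>The frontier of \<open>V\<close> misses \<open>K\<close>, so \<open>V\<close>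
      and its closure have the same trace on \<open>K\<close>, which is therefore clopen relative to
      \<open>K\<close>.\<close>
    have eq: "V \<inter> K = X closure_of V \<inter> K"
      using frC fr VX by (auto simp: K_def)
    have c1: "closedin X (V \<inter> K)"
      unfolding eq using cK by (intro closedin_Int) auto
    have "K - V \<inter> K = K - V" by blast
    then have c2: "closedin X (K - V \<inter> K)"
      using cK V(1) by (simp add: closedin_diff)
    obtain G where G: "clopenin X G" "G \<inter> K = V \<inter> K"
      by (rule clopen_in_C_set_extends[OF assms(2) _ assms(3) K _ c1 c2])
         (use assms(1) metrizable_imp_normal_space in auto)
    have CU: "\<Union>\<C> \<subseteq> U - {x}" by (auto simp: \<C>_def)
    have xG: "x \<in> G"
    proof -
      have "x \<in> V \<inter> K"
        using CU V(2) openin_subset[OF V(1)] unfolding K_def by blast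
      then show ?thesis
        using G(2) by blast
    qed
    \<comment> \<open>There is no control over \<open>G\<close> off \<open>K\<close>, but every
      point off \<open>K\<close> lies in a member of \<open>\<C>\<close> and hence in
      \<open>U\<close>.\<close>
    have "G \<subseteq> U"
    proof
      fix y assume y: "y \<in> G"
      then have "y \<in> topspace X" using G openin_subset by blast
      then show "y \<in> U"
      proof (cases "y \<in> K")
        case True
        then show ?thesis
          using y G(2) V(3) VX by blast
      next
        case False
        then show ?thesis
          using CU \<open>y \<in> topspace X\<close> unfolding K_def by blast
      qed
    qed
    then show ?thesis
      using G xG by blast
  qed
qed

subsection \<open>The dimension of almost zero-dimensional spaces\<close>

text \<open>Two dyadic fractions straddle the midpoint of \<open>s\<close> and \<open>t\<close> at
  distance less than half of \<open>t - s\<close>; the upper one lies in between.\<close>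

lemma dyadic_between:
  fixes s t :: real
  assumes "0 \<le> s" "s < t" "t \<le> 1"
  obtains r where "r \<in> dyadics \<inter> {0..1}" "s < r" "r < t"
proof -
  obtain n q r where *: "of_nat q / 2^n < (s + t) / 2" "(s + t) / 2 < of_nat r / 2^n"
      "\<bar>real q / 2^n - real r / 2^n\<bar> < (t - s) / 2"
    by (rule padic_rational_approximation_straddle_pos[of "(t - s) / 2" 2 "(s + t) / 2"]) (use assms in auto)
  define u v where "u = real q / 2^n" and "v = real r / 2^n"
  have "u < (s + t) / 2" "(s + t) / 2 < v" "\<bar>u - v\<bar> < (t - s) / 2"
    using * by (simp_all add: u_def v_def)
  then have sv: "s < v" and vt: "v < t"
    using assms(2) by (auto simp: field_simps abs_if split: if_splits)
  have "v \<in> dyadics"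
    unfolding dyadics_def v_def by blast
  then show thesis
    using that[of v] sv vt assms by auto
qed

text \<open>
  Lower semicontinuity of \<open>f\<close> with respect to the topology generated by the clopen sets: all
  sets \<open>{f \<le> t}\<close> are C-sets.
\<close>
lemma azd_Urysohn:
  fixes X :: "'a topology"
  assumes "second_countable X" "almost_zero_dimensional X" "C_set_in X A" "openin X W" "A \<subseteq> W"
  obtains f :: "'a \<Rightarrow> real"
  where "continuous_map X euclideanreal f" "\<And>x. f x \<in> {0..1}" "\<And>x. x \<in> A \<Longrightarrow> f x = 0"
    "\<And>x. x \<in> topspace X - W \<Longrightarrow> f x = 1"
    "\<And>x t. x \<in> topspace X \<Longrightarrow> t < f x \<Longrightarrow> \<exists>C. clopenin X C \<and> x \<in> C \<and> (\<forall>y\<in>C. t < f y)"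
proof -
  \<comment> \<open>Both ends are required to be C-sets, so that interpolation can be repeated
    between any two related sets in the dyadic recursion.\<close>
  define R where "R = (\<lambda>S T. C_set_in X S \<and> C_set_in X T \<and> S \<subseteq> X interior_of T)"
  obtain B where B: "C_set_in X B" "A \<subseteq> X interior_of B" "B \<subseteq> W"
    using C_set_in_interpolation[OF assms] by metis
  have "\<exists>G :: real \<Rightarrow> 'a set. G 0 = A \<and> G 1 = B \<and>
     (\<forall>x \<in> dyadics \<inter> {0..1}. \<forall>y \<in> dyadics \<inter> {0..1}. x < y \<longrightarrow> R (G x) (G y))"
  proof (rule recursion_on_dyadic_fractions)
    show "R A B"
      using B assms(3) by (simp add: R_def)
    show "\<exists>S. R T S \<and> R S V" if "R T V" for T V
    proof -
      have TV: "C_set_in X T" "C_set_in X V" "T \<subseteq> X interior_of V"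
        using that by (simp_all add: R_def)
      obtain S where "C_set_in X S" "T \<subseteq> X interior_of S" "S \<subseteq> X interior_of V"
        using C_set_in_interpolation[OF assms(1,2) TV(1) _ TV(3)] openin_interior_of by metis
      then show ?thesis
        using TV by (auto simp: R_def)
    qed
    show "R S V" if "R S T" "R T V" for S T V
      using that interior_of_subset[of X T] unfolding R_def by blast
  qed
  then obtain G :: "real \<Rightarrow> 'a set" where G0: "G 0 = A" and G1: "G 1 = B"
    and G: "\<And>x y. x \<in> dyadics \<inter> {0..1} \<Longrightarrow> y \<in> dyadics \<inter> {0..1} \<Longrightarrow> x < y \<Longrightarrow> R (G x) (G y)"
    by blast
  have dy: "0 \<in> dyadics \<inter> {0..1::real}" "1 \<in> dyadics \<inter> {0..1::real}"
    by (force simp: dyadics_def)+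
  have GC: "C_set_in X (G r)" if "r \<in> dyadics \<inter> {0..1}" for r
  proof (cases "r < 1")
    case True
    then show ?thesis using G[OF that dy(2)] by (simp add: R_def)
  next
    case False
    then have "r = 1" using that by auto
    then show ?thesis using B(1) G1 by simp
  qed
  have Gint: "G r \<subseteq> X interior_of G s"
    if "r \<in> dyadics \<inter> {0..1}" "s \<in> dyadics \<inter> {0..1}" "r < s" for r s
    using G[OF that] by (simp add: R_def)
  have Gmono: "G r \<subseteq> G s" if "r \<in> dyadics \<inter> {0..1}" "s \<in> dyadics \<inter> {0..1}" "r \<le> s" for r s
    using Gint[OF that(1,2)] interior_of_subset[of X "G s"] that(3) by (cases "r = s") auto
  \<comment> \<open>Inserting \<open>1\<close> keeps the infimum over a nonempty set and bounds
    \<open>f\<close> by \<open>1\<close>, also at points in none of the sets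
    \<open>G r\<close>.\<close>
  define I where "I = (\<lambda>x. insert 1 {r. r \<in> dyadics \<inter> {0..1} \<and> x \<in> G r})"
  define f where "f = (\<lambda>x. Inf (I x))"
  have bdd: "bdd_below (I x)" for x
    by (rule bdd_belowI[of _ 0]) (auto simp: I_def)
  have ne: "I x \<noteq> {}" for x
    by (simp add: I_def)
  have le1: "f x \<le> 1" for x
    unfolding f_def by (rule cInf_lower[OF _ bdd]) (simp add: I_def)
  have ge0: "0 \<le> f x" for x
    unfolding f_def by (rule cInf_greatest[OF ne]) (auto simp: I_def)
  have fle: "f x \<le> r" if "r \<in> dyadics \<inter> {0..1}" "x \<in> G r" for x r
    unfolding f_def by (rule cInf_lower[OF _ bdd]) (use that in \<open>simp add: I_def\<close>)
  have fless: "\<exists>r. r \<in> dyadics \<inter> {0..1} \<and> x \<in> G r \<and> r < t" if "f x < t" "t \<le> 1" for x t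
    using that unfolding f_def cInf_less_iff[OF ne bdd] by (auto simp: I_def)
  have fge: "r \<le> f x" if "r \<in> dyadics \<inter> {0..1}" "x \<notin> G r" for x r
  proof (rule ccontr)
    assume "\<not> r \<le> f x"
    then have "\<exists>q. q \<in> dyadics \<inter> {0..1} \<and> x \<in> G q \<and> q < r"
      using that(1) by (intro fless) auto
    then obtain q where "q \<in> dyadics \<inter> {0..1}" "x \<in> G q" "q < r"
      by blast
    then show False
      using Gmono[of q r] that by auto
  qed
  \<comment> \<open>For \<open>t < r < f x\<close> the point \<open>x\<close> is outside the C-set
    \<open>G r\<close>; on a clopen set around \<open>x\<close> missing \<open>G r\<close>, the
    value of \<open>f\<close> is at least \<open>r\<close>. Negative \<open>t\<close> are treated
    apart because the dyadics used lie in the unit interval.\<close>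
  have lsc: "\<exists>C. clopenin X C \<and> x \<in> C \<and> (\<forall>y\<in>C. t < f y)"
    if x: "x \<in> topspace X" and t: "t < f x" for x t
  proof (cases "t < 0")
    case True
    then have "\<forall>y\<in>topspace X. t < f y"
      using ge0 by (meson less_le_trans)
    then show ?thesis
      using x by (intro exI[of _ "topspace X"]) auto
  next
    case False
    then obtain r where r: "r \<in> dyadics \<inter> {0..1}" "t < r" "r < f x"
      using dyadic_between[of t "f x"] t le1 by auto
    then have "x \<notin> G r"
      using fle by force
    then obtain C where "clopenin X C" "x \<in> C" "C \<inter> G r = {}"
      using C_set_in_separate_point[OF GC[OF r(1)] x] by metis
    moreover have "t < f y" if "y \<in> C" for y
      using fge[OF r(1), of y] r(2) that calculation(3) by (meson disjoint_iff less_le_trans)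
    ultimately show ?thesis
      by blast
  qed
  \<comment> \<open>Here only an open set is obtained, namely the interior of \<open>G s\<close> for
    some \<open>s\<close> between \<open>r\<close> and \<open>t\<close>.\<close>
  have usc: "\<exists>U. openin X U \<and> x \<in> U \<and> (\<forall>y\<in>U. f y < t)"
    if x: "x \<in> topspace X" and t: "f x < t" for x t
  proof (cases "1 < t")
    case True
    then have "\<forall>y\<in>topspace X. f y < t"
      using le1 by (meson le_less_trans)
    then show ?thesis
      using x by (intro exI[of _ "topspace X"]) auto
  next
    case False
    then obtain r where r: "r \<in> dyadics \<inter> {0..1}" "x \<in> G r" "r < t"
      using fless[of x t] t by auto
    obtain s where s: "s \<in> dyadics \<inter> {0..1}" "r < s" "s < t"
      using dyadic_between[of r t] r False by auto
    have "x \<in> X interior_of G s"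
      using Gint[OF r(1) s(1,2)] r(2) by blast
    moreover have "f y < t" if "y \<in> X interior_of G s" for y
      using fle[OF s(1), of y] interior_of_subset[of X "G s"] s(3) that by force
    ultimately show ?thesis
      using openin_interior_of by blast
  qed
  show thesis
  proof
    show "continuous_map X euclideanreal f"
      unfolding continuous_map_upper_lower_semicontinuous_lt
    proof (intro conjI allI)
      fix t
      show "openin X {x \<in> topspace X. f x < t}"
      proof (subst openin_subopen, intro ballI)
        fix x assume "x \<in> {x \<in> topspace X. f x < t}"
        then obtain U where U: "openin X U" "x \<in> U" "\<forall>y\<in>U. f y < t"
          using usc by blast
        then show "\<exists>T. openin X T \<and> x \<in> T \<and> T \<subseteq> {x \<in> topspace X. f x < t}"
          using openin_subset[OF U(1)] by blast
      qed
      show "openin X {x \<in> topspace X. f x > t}"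
      proof (subst openin_subopen, intro ballI)
        fix x assume "x \<in> {x \<in> topspace X. f x > t}"
        then obtain U where U: "openin X U" "x \<in> U" "\<forall>y\<in>U. t < f y"
          using lsc by blast
        then show "\<exists>T. openin X T \<and> x \<in> T \<and> T \<subseteq> {x \<in> topspace X. f x > t}"
          using openin_subset[OF U(1)] by blast
      qed
    qed
    show "f x \<in> {0..1}" for x
      using ge0 le1 by simp
    show "f x = 0" if "x \<in> A" for x
      using fle[OF dy(1), of x] ge0[of x] G0 that by simp
    show "f x = 1" if "x \<in> topspace X - W" for x
      using fge[OF dy(2), of x] le1[of x] B(3) G1 that by auto
  qed (fact lsc)
qed

text \<open>One Urysohn function is taken for each base set \<open>b i\<close> and each member
  \<open>D i n\<close> of a C-set exhaustion of it. The pairs are coded by natural numbers so that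
  the functions can be summed.\<close>

lemma azd_separating_functions:
  fixes X :: "'a topology"
  assumes "second_countable X" "almost_zero_dimensional X"
  obtains f :: "nat \<Rightarrow> 'a \<Rightarrow> real"
  where "\<And>i. continuous_map X euclideanreal (f i)" "\<And>i x. f i x \<in> {0..1}"
    "\<And>U x. openin X U \<Longrightarrow> x \<in> U \<Longrightarrow> \<exists>i. f i x = 0 \<and> (\<forall>y\<in>topspace X - U. f i y = 1)"
    "\<And>i x t. x \<in> topspace X \<Longrightarrow> t < f i x \<Longrightarrow> \<exists>C. clopenin X C \<and> x \<in> C \<and> (\<forall>y\<in>C. t < f i y)"
proof -
  obtain \<B> where \<B>: "countable \<B>" "\<And>V. V \<in> \<B> \<Longrightarrow> openin X V"
    and base: "\<And>U x. openin X U \<and> x \<in> U \<longrightarrow> (\<exists>V \<in> \<B>. x \<in> V \<and> V \<subseteq> U)"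
    using assms by (auto simp: second_countable_def)
  define b where "b = from_nat_into (insert {} \<B>)"
  have rng: "range b = insert {} \<B>"
    unfolding b_def using \<B>(1) by (intro range_from_nat_into) auto
  have bopen: "openin X (b i)" for i
  proof -
    have "b i \<in> insert {} \<B>"
      using rng by blast
    then show ?thesis
      using \<B>(2) by auto
  qed
  have "\<exists>D :: nat \<Rightarrow> 'a set. (\<forall>n. C_set_in X (D n)) \<and> (\<forall>n. D n \<subseteq> b i) \<and> b i \<subseteq> (\<Union>n. X interior_of D n)" for i
    using azd_open_exhaustion[OF assms bopen[of i]] by metis
  then obtain D :: "nat \<Rightarrow> nat \<Rightarrow> 'a set" where D: "\<And>i n. C_set_in X (D i n)" "\<And>i n. D i n \<subseteq> b i"
      "\<And>i. b i \<subseteq> (\<Union>n. X interior_of D i n)"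
    by metis
  have "\<exists>f :: 'a \<Rightarrow> real. continuous_map X euclideanreal f \<and> (\<forall>x. f x \<in> {0..1}) \<and> (\<forall>x\<in>D i n. f x = 0) \<and>
      (\<forall>x \<in> topspace X - b i. f x = 1) \<and>
      (\<forall>x\<in>topspace X. \<forall>t<f x. \<exists>C. clopenin X C \<and> x \<in> C \<and> (\<forall>y\<in>C. t < f y))" for i n
    by (rule azd_Urysohn[OF assms D(1)[of i n] bopen D(2)]) blast
  then obtain g :: "nat \<Rightarrow> nat \<Rightarrow> 'a \<Rightarrow> real" where
    g: "\<And>i n. continuous_map X euclideanreal (g i n)" "\<And>i n x. g i n x \<in> {0..1}"
      "\<And>i n x. x \<in> D i n \<Longrightarrow> g i n x = 0" "\<And>i n x. x \<in> topspace X - b i \<Longrightarrow> g i n x = 1"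
      "\<And>i n x t. x \<in> topspace X \<Longrightarrow> t < g i n x \<Longrightarrow>
          \<exists>C. clopenin X C \<and> x \<in> C \<and> (\<forall>y\<in>C. t < g i n y)"
    by metis
  define f where "f = (\<lambda>k. g (fst (prod_decode k)) (snd (prod_decode k)))"
  show thesis
  proof
    show "continuous_map X euclideanreal (f i)" for i
      unfolding f_def by (rule g)
    show "f i x \<in> {0..1}" for i x
      unfolding f_def by (rule g)
    show "\<exists>C. clopenin X C \<and> x \<in> C \<and> (\<forall>y\<in>C. t < f i y)"
      if "x \<in> topspace X" "t < f i x" for i x t
      using that unfolding f_def by (rule g)
    show "\<exists>i. f i x = 0 \<and> (\<forall>y\<in>topspace X - U. f i y = 1)" if "openin X U" "x \<in> U" for U x
    proof -
      obtain V where V: "V \<in> \<B>" "x \<in> V" "V \<subseteq> U"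
        using base \<open>openin X U\<close> \<open>x \<in> U\<close> by blast
      moreover obtain i where i: "V = b i"
        using rng V(1) by (metis imageE insertI2)
      moreover obtain n where "x \<in> X interior_of D i n"
        using D(3)[of i] V(2) i by blast
      then have "x \<in> D i n"
        using interior_of_subset by fastforce
      ultimately show ?thesis
        using g(3,4)[of _ i] by (intro exI[of _ "prod_encode (i, n)"]) (auto simp: f_def)
    qed
  qed
qed

text \<open>
  On a level set of \<open>\<phi>\<close> all the \<open>f i\<close> become upper semicontinuous for the topology
  generated by the clopen sets, being a level minus a sum of lower semicontinuous functions.
\<close>
lemma azd_level_function:
  fixes X :: "'a topology"
  assumes "second_countable X" "almost_zero_dimensional X"
  obtains \<phi> :: "'a \<Rightarrow> real"
  where "continuous_map X euclideanreal \<phi>"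
    "\<And>U x. openin X U \<Longrightarrow> x \<in> U \<Longrightarrow>
        \<exists>C \<delta>. clopenin X C \<and> x \<in> C \<and> \<delta> > 0 \<and> (\<forall>y\<in>C. \<phi> y < \<phi> x + \<delta> \<longrightarrow> y \<in> U)"
proof -
  obtain f :: "nat \<Rightarrow> 'a \<Rightarrow> real" where
    f: "\<And>i. continuous_map X euclideanreal (f i)" "\<And>i x. f i x \<in> {0..1}"
    and sep: "\<And>U x. openin X U \<Longrightarrow> x \<in> U \<Longrightarrow> \<exists>i. f i x = 0 \<and> (\<forall>y\<in>topspace X - U. f i y = 1)"
    and lsc: "\<And>i x t. x \<in> topspace X \<Longrightarrow> t < f i x \<Longrightarrow>
       \<exists>C. clopenin X C \<and> x \<in> C \<and> (\<forall>y\<in>C. t < f i y)"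
    by (erule azd_separating_functions[OF assms])
  \<comment> \<open>Geometric weights make the series converge uniformly and bound its tail from
    \<open>N\<close> on by \<open>2 * (1/2)^N\<close>.\<close>
  define g where "g = (\<lambda>i x. (1/2)^i * f i x)"
  define \<phi> where "\<phi> = (\<lambda>x. \<Sum>i. g i x)"
  have g0: "0 \<le> g i x" and g1: "g i x \<le> (1/2)^i" for i x
    using f(2)[of i x] by (auto simp: g_def mult_left_le)
  have sumg: "summable (\<lambda>i. g i x)" for x
    by (rule summable_comparison_test'[of "\<lambda>i. (1/2)^i" 0]) (use g0 g1 in \<open>auto simp: summable_geometric\<close>)
  have lower: "(\<Sum>i<N. g i x) \<le> \<phi> x" for N x
    unfolding \<phi>_def by (rule sum_le_suminf[OF sumg]) (use g0 in auto)
  have upper: "\<phi> x \<le> (\<Sum>i<N. g i x) + 2 * (1/2)^N" for N x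
  proof -
    have "\<phi> x = (\<Sum>i. g (i + N) x) + (\<Sum>i<N. g i x)"
      unfolding \<phi>_def by (rule suminf_split_initial_segment[OF sumg])
    also have "(\<Sum>i. g (i + N) x) \<le> (\<Sum>i. (1/2)^N * (1/2)^i)"
    proof (rule suminf_le)
      show "g (i + N) x \<le> (1/2)^N * (1/2)^i" for i
        using g1[of "i + N" x] by (simp add: power_add mult.commute)
      show "summable (\<lambda>i. g (i + N) x)"
        using sumg[of x] by (subst summable_iff_shift)
      show "summable (\<lambda>i. (1/2)^N * (1/2)^i :: real)"
        by (intro summable_mult summable_geometric) auto
    qed
    also have "(\<Sum>i. (1/2)^N * (1/2)^i :: real) = 2 * (1/2)^N"
      by (subst suminf_mult) (auto simp: summable_geometric suminf_geometric)
    finally show ?thesis by simp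
  qed
  have small: "\<exists>N>i. 2 * (1/2)^N < \<eta>" if \<eta>: "\<eta> > 0" for \<eta> :: real and i :: nat
  proof -
    obtain N where N: "(1/2::real)^N < \<eta> / 2"
      using real_arch_pow_inv[of "\<eta>/2" "1/2::real"] \<eta> by auto
    have "(1/2)^(max N (Suc i)) \<le> (1/2::real)^N"
      by (intro power_decreasing) auto
    then have "2 * (1/2)^(max N (Suc i)) < \<eta>"
      using N by linarith
    moreover have "i < max N (Suc i)"
      by simp
    ultimately show ?thesis
      by blast
  qed
  have contg: "continuous_map X euclideanreal (\<lambda>x. \<Sum>i<N. g i x)" for N
    unfolding g_def by (intro continuous_map_sum continuous_map_real_mult f) auto
  have "continuous_map X Met_TC.mtopology \<phi>"
  proof (rule Met_TC.continuous_map_uniform_limit[where F = sequentially and f = "\<lambda>N x. \<Sum>i<N. g i x"])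
    show "\<forall>\<^sub>F N in sequentially. continuous_map X Met_TC.mtopology (\<lambda>x. \<Sum>i<N. g i x)"
      using contg by simp
    fix \<epsilon> :: real assume "\<epsilon> > 0"
    then obtain M where M: "2 * (1/2)^M < \<epsilon>"
      using small by blast
    have "dist (\<Sum>i<N. g i x) (\<phi> x) < \<epsilon>" if "N \<ge> M" for N x
    proof -
      have "(1/2)^N \<le> (1/2::real)^M"
        using that by (intro power_decreasing) auto
      then show ?thesis
        using lower[where x = x and N = N] upper[where x = x and N = N] M unfolding dist_real_def by linarith
    qed
    then show "\<forall>\<^sub>F N in sequentially. \<forall>x\<in>topspace X. \<phi> x \<in> UNIV \<and> dist (\<Sum>i<N. g i x) (\<phi> x) < \<epsilon>"
      unfolding eventually_sequentially by blast
  qed simp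
  then have cont: "continuous_map X euclideanreal \<phi>"
    by simp
  have near: "\<exists>C \<delta>. clopenin X C \<and> x \<in> C \<and> \<delta> > 0 \<and> (\<forall>y\<in>C. \<phi> y < \<phi> x + \<delta> \<longrightarrow> y \<in> U)"
    if U: "openin X U" "x \<in> U" for U x
  proof -
    have x: "x \<in> topspace X"
      using U openin_subset by blast
    obtain i where i: "f i x = 0" "\<And>y. y \<in> topspace X - U \<Longrightarrow> f i y = 1"
      using sep[OF U] by blast
    \<comment> \<open>A quarter of the \<open>i\<close>-th weight: if \<open>y\<close> were outside
      \<open>U\<close>, passing from \<open>x\<close> to \<open>y\<close> would gain
      \<open>4 * \<eta>\<close> in the \<open>i\<close>-th term, lose at most \<open>\<eta>\<close>
      in the other terms below \<open>N\<close>, and less than \<open>\<eta>\<close> by ignoring the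
      tail. Thus \<open>\<phi> y\<close> would exceed \<open>\<phi> x + \<eta>\<close>.\<close>
    define \<eta> :: real where "\<eta> = (1/2)^i / 4"
    have \<eta>: "\<eta> > 0" by (simp add: \<eta>_def)
    obtain N where N: "i < N" "2 * (1/2)^N < \<eta>"
      using small[OF \<eta>] by blast
    \<comment> \<open>The weights sum to at most \<open>2\<close>, so a loss of
      \<open>\<eta> / 2\<close> in each function costs at most \<open>\<eta>\<close> in
      total.\<close>
    have "\<exists>C. clopenin X C \<and> x \<in> C \<and> (\<forall>y\<in>C. f j x - \<eta> / 2 < f j y)" for j
      using lsc[OF x, of "f j x - \<eta> / 2" j] \<eta> by auto
    then obtain C where C: "\<And>j. clopenin X (C j)" "\<And>j. x \<in> C j"
        "\<And>j y. y \<in> C j \<Longrightarrow> f j x - \<eta> / 2 < f j y"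
      by metis
    define C' where "C' = topspace X \<inter> (\<Inter>j<N. C j)"
    have clo: "clopenin X C'"
      unfolding C'_def using C(1) by (rule clopenin_INT_lessThan)
    have "y \<in> U" if y: "y \<in> C'" "\<phi> y < \<phi> x + \<eta>" for y
    proof (rule ccontr)
      assume "y \<notin> U"
      then have fy: "f i y = 1"
        using i(2) y(1) by (auto simp: C'_def)
      have gle: "g j x - (1/2)^j * (\<eta>/2) \<le> g j y" if "j < N" for j
      proof -
        have "f j x - \<eta> / 2 \<le> f j y"
          using C(3)[of y j] y(1) that unfolding C'_def by force
        then have "(1/2)^j * (f j x - \<eta>/2) \<le> (1/2)^j * f j y"
          by (intro mult_left_mono) auto
        then show ?thesis
          by (simp add: g_def right_diff_distrib)
      qed
      have geo: "(\<Sum>j\<in>J. (1/2)^j * (\<eta>/2)) \<le> \<eta>" if "finite J" for J :: "nat set"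
      proof -
        have "(\<Sum>j\<in>J. (1/2::real)^j) \<le> (\<Sum>j. (1/2)^j)"
          by (rule sum_le_suminf) (use that in \<open>auto simp: summable_geometric\<close>)
        then have "(\<Sum>j\<in>J. (1/2::real)^j) \<le> 2"
          by (simp add: suminf_geometric)
        then have "(\<Sum>j\<in>J. (1/2)^j) * (\<eta>/2) \<le> 2 * (\<eta>/2)"
          using \<eta> by (intro mult_right_mono) auto
        then show ?thesis
          unfolding sum_distrib_right by simp
      qed
      have split: "(\<Sum>j<N. h j) = h i + (\<Sum>j\<in>{..<N}-{i}. h j)" for h :: "nat \<Rightarrow> real"
        using N(1) by (intro sum.remove) auto
      have "(\<Sum>j\<in>{..<N}-{i}. g j x - (1/2)^j * (\<eta>/2)) \<le> (\<Sum>j\<in>{..<N}-{i}. g j y)"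
        by (intro sum_mono gle) auto
      then have "(\<Sum>j\<in>{..<N}-{i}. g j x) - \<eta> \<le> (\<Sum>j\<in>{..<N}-{i}. g j y)"
        using geo[of "{..<N}-{i}"] by (simp add: sum_subtractf)
      moreover have "g i y = 4 * \<eta>" "g i x = 0"
        using fy i(1) by (simp_all add: g_def \<eta>_def)
      ultimately have "(\<Sum>j<N. g j x) + 3 * \<eta> \<le> (\<Sum>j<N. g j y)"
        unfolding split by linarith
      then show False
        using lower[where x = y and N = N] upper[where x = x and N = N] N(2) y(2) \<eta> by linarith
    qed
    then show ?thesis
      using clo C(2) x \<eta> by (intro exI[of _ C'] exI[of _ \<eta>]) (auto simp: C'_def)
  qed
  show thesis
    using that[OF cont near] by blast
qed

text \<open>The sets \<open>C \<inter> {\<phi> < t}\<close> with \<open>C\<close> clopen give small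
  neighbourhoods whose frontiers lie in level sets of \<open>\<phi>\<close>. On a level set the
  bound on \<open>\<phi>\<close> holds automatically, so traces of clopen sets form a base
  there.\<close>

lemma azd_dim_le_1:
  fixes X :: "'a topology"
  assumes "second_countable X" "almost_zero_dimensional X"
  shows "X dim_le 1"
proof -
  obtain \<phi> :: "'a \<Rightarrow> real" where cont: "continuous_map X euclideanreal \<phi>"
    and near: "\<And>U x. openin X U \<Longrightarrow> x \<in> U \<Longrightarrow>
        \<exists>C \<delta>. clopenin X C \<and> x \<in> C \<and> \<delta> > 0 \<and> (\<forall>y\<in>C. \<phi> y < \<phi> x + \<delta> \<longrightarrow> y \<in> U)"
    by (erule azd_level_function[OF assms])
  have level: "subtopology X {x \<in> topspace X. \<phi> x = t} dim_le 0" (is "?F dim_le 0") for t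
    unfolding dimension_le_0_neighbourhood_base_of_clopen neighbourhood_base_of
  proof (intro allI impI, elim conjE)
    fix W x assume W: "openin ?F W" "x \<in> W"
    then obtain U where U: "openin X U" "W = U \<inter> {x \<in> topspace X. \<phi> x = t}"
      unfolding openin_subtopology by metis
    have "x \<in> U" "\<phi> x = t"
      using U(2) W(2) by simp_all
    then obtain C \<delta> where C: "clopenin X C" "x \<in> C" "\<delta> > 0" "\<And>y. y \<in> C \<Longrightarrow> \<phi> y < t + \<delta> \<Longrightarrow> y \<in> U"
      using near[OF U(1)] by metis
    define V where "V = {x \<in> topspace X. \<phi> x = t} \<inter> C"
    have "clopenin ?F V"
      unfolding V_def using C(1) by (auto intro: closedin_subtopology_Int_closed openin_subtopology_Int2)
    moreover have "x \<in> V"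
      using C(2) U(2) W(2) by (simp add: V_def)
    moreover have "V \<subseteq> W"
      using C(3,4) U(2) by (auto simp: V_def)
    ultimately show "\<exists>U V. openin ?F U \<and> clopenin ?F V \<and> x \<in> U \<and> U \<subseteq> V \<and> V \<subseteq> W"
      by blast
  qed
  show ?thesis
  proof (rule dimension_le.intros)
    fix W x assume W: "openin X W" "x \<in> W"
    obtain C \<delta> where C: "clopenin X C" "x \<in> C" "\<delta> > 0" "\<And>y. y \<in> C \<Longrightarrow> \<phi> y < \<phi> x + \<delta> \<Longrightarrow> y \<in> W"
      using near[OF W] by metis
    define t where "t = \<phi> x + \<delta>"
    define V where "V = C \<inter> {y \<in> topspace X. \<phi> y < t}"
    have op: "openin X V"
      unfolding V_def using C(1) cont
      by (intro openin_Int) (auto simp: continuous_map_upper_lower_semicontinuous_lt)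
    have "closedin X (C \<inter> {y \<in> topspace X. \<phi> y \<le> t})"
      using C(1) cont by (intro closedin_Int) (auto simp: continuous_map_upper_lower_semicontinuous_le)
    then have "X closure_of V \<subseteq> C \<inter> {y \<in> topspace X. \<phi> y \<le> t}"
      by (intro closure_of_minimal) (auto simp: V_def)
    then have "X frontier_of V \<subseteq> {y \<in> topspace X. \<phi> y = t}"
      using op by (auto simp: frontier_of_def interior_of_openin V_def)
    then have "subtopology X (X frontier_of V) dim_le 1 - 1"
      using dimension_le_subtopologies[OF level] by simp
    moreover have "x \<in> V" "V \<subseteq> W"
      using C openin_subset[OF W(1)] W(2) by (auto simp: V_def t_def)
    ultimately show "\<exists>U. x \<in> U \<and> U \<subseteq> W \<and> openin X U \<and> subtopology X (X frontier_of U) dim_le 1 - 1"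
      using op by blast
  qed simp
qed

section \<open>Comparison of the dimensions of \<open>\<Lambda> X\<close> and
  \<open>X\<close>\<close>

lemma topdim_dimensional_kernel:
  fixes X :: "'a topology"
  assumes "metrizable_space X" "separable_space X" "almost_zero_dimensional X"
  shows "topdim (subtopology X (\<Lambda> X)) = topdim X"
proof -
  have sc: "second_countable X"
    using assms(1,2) by (rule separable_metrizable_imp_second_countable)
  have dim1: "X dim_le 1"
    using sc assms(3) by (rule azd_dim_le_1)
  have le: "topdim (subtopology X (\<Lambda> X)) \<le> 1" "topdim X \<le> 1"
    using topdim_le_iff[of X 1] topdim_le_iff[of "subtopology X (\<Lambda> X)" 1]
      dimension_le_subtopology[OF dim1] dim1 by (simp_all add: one_enat_def)
  \<comment> \<open>As \<open>X\<close> has dimension at most \<open>1\<close>, the neighbourhood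
    condition in \<open>one_dimensional_at\<close> holds at every point; outside
    \<open>\<Lambda> X\<close> only zero-dimensionality is left.\<close>
  have off: "zero_dimensional_at X x" if "x \<in> topspace X - \<Lambda> X" for x
  proof -
    have "topdim Y \<le> 0 \<longleftrightarrow> Y dim_le 0" for Y :: "'a topology"
      using topdim_le_iff[of Y 0] by (simp add: zero_enat_def)
    then have "neighbourhood_base_of
        (\<lambda>U. openin X U \<and> topdim (subtopology X (X frontier_of U)) \<le> 0) X"
      using dim1 by (simp add: dimension_le_neighbourhood_base[of X 1])
    then have "neighbourhood_base_at x
        (\<lambda>U. openin X U \<and> topdim (subtopology X (X frontier_of U)) \<le> 0) X"
      using that by (simp add: neighbourhood_base_of_def)
    then show ?thesis
      using that by (auto simp: dimensional_kernel_def one_dimensional_at_def)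
  qed
  \<comment> \<open>Both dimensions are \<open>0\<close> or \<open>1\<close>, so it is enough that
    they vanish together.\<close>
  have "topdim X = 0 \<longleftrightarrow> topdim (subtopology X (\<Lambda> X)) = 0"
  proof
    assume "topdim X = 0"
    then have "X dim_le 0"
      by (simp add: topdim_eq_0_iff dimension_le_0_neighbourhood_base_of_clopen)
    then have "subtopology X (\<Lambda> X) dim_le 0"
      by (rule dimension_le_subtopology)
    then show "topdim (subtopology X (\<Lambda> X)) = 0"
      by (simp add: topdim_eq_0_iff dimension_le_0_neighbourhood_base_of_clopen)
  next
    assume "topdim (subtopology X (\<Lambda> X)) = 0"
    then show "topdim X = 0"
      using azd_zero_dimensional_from_subset[OF assms(1) sc assms(3) _ off] by (simp add: topdim_eq_0_iff)
  qed
  moreover have "n = 0 \<or> n = 1" if "n \<le> 1" for n :: enat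
    using that by (cases n) (auto simp: one_enat_def zero_enat_def)
  ultimately show ?thesis
    using le by metis
qed

theorem theorem1:
  shows "(\<forall>X :: 'a topology.
            metrizable_space X \<and> separable_space X \<and> almost_zero_dimensional X
              \<longrightarrow> topdim (subtopology X (\<Lambda> X)) = topdim X)
       \<and> \<not> (\<exists>X :: 'a topology.
            metrizable_space X \<and> separable_space X \<and>
            weakly_one_dimensional X \<and> almost_zero_dimensional X)"
proof (intro conjI allI impI notI)
  show "topdim (subtopology X (\<Lambda> X)) = topdim X"
    if "metrizable_space X \<and> separable_space X \<and> almost_zero_dimensional X" for X :: "'a topology"
    using that topdim_dimensional_kernel by blast
  assume "\<exists>X :: 'a topology. metrizable_space X \<and> separable_space X \<and>
            weakly_one_dimensional X \<and> almost_zero_dimensional X"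
  then obtain X :: "'a topology" where "metrizable_space X" "separable_space X"
      "weakly_one_dimensional X" "almost_zero_dimensional X"
    by blast
  \<comment> \<open>Weak one-dimensionality would turn the equality of dimensions into
    \<open>0 = 1\<close>.\<close>
  then show False
    using topdim_dimensional_kernel[of X] by (auto simp: weakly_one_dimensional_def)
qed

end
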